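(* The self-adjoint equation $Lx=0$ has a solution $x$ without zeros on $\mathcal I$ if and only if the Riccati equation $Rz=0$ has a solution $z$ on $\mathcal I$. Moreover, these two solutions satisfy $$z=\frac{pD^{\alpha}x}{x}\qquad\text{on }\mathcal I$$ (that is, given a zero-free solution $x$ of $Lx=0$, this formula defines a solution $z$ of $Rz=0$; and given a solution $z$ of $Rz=0$ there is a zero-free solution $x$ of $Lx=0$ for which this formula holds).
   Context: $\mathcal I\subseteq\mathbb R$ is a nondegenerate interval. The functions $\kappa_0,\kappa_1:[0,1]\times\mathcal I\to[0,\infty)$ are continuous and satisfy, for all $t\in\mathcal I$: $\lim_{\alpha\to0^+}\kappa_1(\alpha,t)=1$, $\lim_{\alpha\to0^+}\kappa_0(\alpha,t)=0$, $\lim_{\alpha\to1^-}\kappa_1(\alpha,t)=0$, $\lim_{\alpha\to1^-}\kappa_0(\alpha,t)=1$, $\kappa_1(\alpha,t)\ne0$ for $\alpha\in[0,1)$, and $\kappa_0(\alpha,t)\neq0$ for $\alpha\in(0,1]$. Fix $\alpha\in(0,1]$ and write $\kappa_j(t)=\kappa_j(\alpha,t)$. The conformable (proportional) derivative is $D^{\alpha}f(t)=\kappa_1(t)f(t)+\kappa_0(t)f'(t)$. Let $p,q$ be continuous on $\mathcal I$ with $p(t)>0$ for all $t\in\mathcal I$, and set $Lx=D^{\alpha}[pD^{\alpha}x]+qx$. A solution of $Lx=0$ on $\mathcal I$ is a continuous function $x$ on $\mathcal I$ such that $D^{\alpha}x$ and $D^{\alpha}[pD^{\alpha}x]$ exist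 and are continuous on $\mathcal I$ and $Lx(t)=0$ for all $t\in\mathcal I$. The Riccati operator is $Rz=D^{\alpha}z+q+\frac{z^2}{p}-\kappa_1z$; a solution of $Rz=0$ on $\mathcal I$ is a differentiable function $z$ on $\mathcal I$ with $D^{\alpha}z$ continuous and $Rz(t)=0$ for all $t\in\mathcal I$. *)

theory Defs
  imports "HOL-Analysis.Analysis"
begin

text \<open>
  The operators below take the coefficient functions \<open>k0\<close>, \<open>k1\<close> of the variable \<open>t\<close>
  alone; they stand for \<open>\<kappa>0 \<alpha>\<close> and \<open>\<kappa>1 \<alpha>\<close> with \<open>\<alpha>\<close> fixed.  Derivatives are taken within
  the interval \<open>I\<close>, so they are one-sided at endpoints belonging to \<open>I\<close> and the ordinary
  derivative at interior points.
\<close>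

definition conf_deriv ::
  "(real \<Rightarrow> real) \<Rightarrow> (real \<Rightarrow> real) \<Rightarrow> real set \<Rightarrow> (real \<Rightarrow> real) \<Rightarrow> real \<Rightarrow> real" where
  "conf_deriv k0 k1 I f t = k1 t * f t + k0 t * vector_derivative f (at t within I)"

definition sa_op ::
  "(real \<Rightarrow> real) \<Rightarrow> (real \<Rightarrow> real) \<Rightarrow> real set \<Rightarrow> (real \<Rightarrow> real) \<Rightarrow> (real \<Rightarrow> real) \<Rightarrow>
   (real \<Rightarrow> real) \<Rightarrow> real \<Rightarrow> real" where
  "sa_op k0 k1 I p q x t =
     conf_deriv k0 k1 I (\<lambda>s. p s * conf_deriv k0 k1 I x s) t + q t * x t"

definition riccati_op ::
  "(real \<Rightarrow> real) \<Rightarrow> (real \<Rightarrow> real) \<Rightarrow> real set \<Rightarrow> (real \<Rightarrow> real) \<Rightarrow> (real \<Rightarrow> real) \<Rightarrow>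
   (real \<Rightarrow> real) \<Rightarrow> real \<Rightarrow> real" where
  "riccati_op k0 k1 I p q z t =
     conf_deriv k0 k1 I z t + q t + (z t)\<^sup>2 / p t - k1 t * z t"

text \<open>
  \<^const>\<open>vector_derivative\<close> is total, so the existence of a conformable derivative of \<open>f\<close>
  is stated separately, as differentiability of \<open>f\<close> on \<open>I\<close>.
\<close>

definition sa_solution ::
  "(real \<Rightarrow> real) \<Rightarrow> (real \<Rightarrow> real) \<Rightarrow> real set \<Rightarrow> (real \<Rightarrow> real) \<Rightarrow> (real \<Rightarrow> real) \<Rightarrow>
   (real \<Rightarrow> real) \<Rightarrow> bool" where
  "sa_solution k0 k1 I p q x \<longleftrightarrow>
     continuous_on I x \<and>
     x differentiable_on I \<and>
     continuous_on I (conf_deriv k0 k1 I x) \<and>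
     (\<lambda>t. p t * conf_deriv k0 k1 I x t) differentiable_on I \<and>
     continuous_on I (conf_deriv k0 k1 I (\<lambda>t. p t * conf_deriv k0 k1 I x t)) \<and>
     (\<forall>t\<in>I. sa_op k0 k1 I p q x t = 0)"

definition riccati_solution ::
  "(real \<Rightarrow> real) \<Rightarrow> (real \<Rightarrow> real) \<Rightarrow> real set \<Rightarrow> (real \<Rightarrow> real) \<Rightarrow> (real \<Rightarrow> real) \<Rightarrow>
   (real \<Rightarrow> real) \<Rightarrow> bool" where
  "riccati_solution k0 k1 I p q z \<longleftrightarrow>
     z differentiable_on I \<and>
     continuous_on I (conf_deriv k0 k1 I z) \<and>
     (\<forall>t\<in>I. riccati_op k0 k1 I p q z t = 0)"

end

theory Submission
  imports Defs
begin

text \<open>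
  The Riccati substitution: for zero-free \<open>x\<close> put \<open>z = p D x / x\<close>.  The quotient rule gives
  \<open>D z = D (p D x) / x - z (D x - k1 x) / x\<close>, in which \<open>D (p D x) = - q x\<close> and
  \<open>D x / x = z / p\<close>.  Conversely, \<open>D x / x = z / p\<close> is the linear equation
  \<open>x' = x (z / p - k1) / k0\<close>, which the exponential of an antiderivative solves on all of
  the interval.
\<close>

text \<open>The interval may be open, half-open or unbounded, while the fundamental theorem of
  calculus is available on compact intervals. All integrals start at one base point
  \<open>c\<close>, so a single \<open>G\<close> serves every \<open>t\<close>; differentiability at
  \<open>t\<close> is checked on a compact subinterval that contains \<open>c\<close> and is a
  neighbourhood of \<open>t\<close> relative to \<open>I\<close>.\<close>

lemma interval_antiderivative_exists:
  fixes g :: "real \<Rightarrow> real"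
  assumes "is_interval I" and g: "continuous_on I g"
  obtains G where "\<And>t. t \<in> I \<Longrightarrow> (G has_real_derivative g t) (at t within I)"
proof (cases "I = {}")
  case False
  then obtain c where c: "c \<in> I" by blast
  define G where "G = (\<lambda>t. LBINT y=c..t. g y)"
  have "(G has_real_derivative g t) (at t within I)" if t: "t \<in> I" for t
  proof -
    \<comment> \<open>The bound \<open>l\<close> marks how far to the left of \<open>t\<close> the
      sets \<open>I\<close> and \<open>{a..b}\<close> agree. If \<open>t\<close> is the left
      endpoint of \<open>I\<close>, then \<open>a = t\<close> and \<open>t - 1\<close> is an
      arbitrary choice of \<open>l\<close>. The pair \<open>b\<close>, \<open>u\<close> below is the
      mirror image.\<close>
    obtain a l where a: "a \<in> I" "a \<le> t" "a \<le> c" "l < t" "\<And>y. y \<in> I \<Longrightarrow> l < y \<Longrightarrow> a \<le> y"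
    proof (cases "\<exists>s\<in>I. s < t")
      case True
      then obtain s where "s \<in> I" "s < t" by blast
      then show ?thesis using that[of "min s c" s] c by (auto simp: min_def)
    next
      case False
      then show ?thesis using that[of t "t - 1"] c t by force
    qed
    obtain b u where b: "b \<in> I" "t \<le> b" "c \<le> b" "t < u" "\<And>y. y \<in> I \<Longrightarrow> y < u \<Longrightarrow> y \<le> b"
    proof (cases "\<exists>s\<in>I. t < s")
      case True
      then obtain s where "s \<in> I" "t < s" by blast
      then show ?thesis using that[of "max s c" s] c by (auto simp: max_def)
    next
      case False
      then show ?thesis using that[of t "t + 1"] c t by force
    qed
    have sub: "{a..b} \<subseteq> I"
      using assms(1) a(1) b(1) unfolding is_interval_1 atLeastAtMost_iff subset_iff by blast
    have "(G has_vector_derivative g t) (at t within {a..b})"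
      unfolding G_def using a b sub
      by (intro interval_integral_FTC2) (auto intro: continuous_on_subset[OF g])
    \<comment> \<open>Inside the window \<open>{l<..<u}\<close> the sets \<open>I\<close> and
      \<open>{a..b}\<close> coincide, so the two filters are equal and the derivative carries over
      to \<open>I\<close>.\<close>
    moreover have "at t within {a..b} = at t within I"
      by (rule at_within_nhd[of t "{l<..<u}"]) (use a b sub in auto)
    ultimately show ?thesis
      by (simp add: has_real_derivative_iff_has_vector_derivative)
  qed
  then show ?thesis by (rule that)
qed (use that in auto)

text \<open>\<open>vector_derivative\<close> is a Hilbert choice; it equals a given derivative
  because limits along a nontrivial filter are unique.\<close>

lemma conf_deriv_eq:
  assumes "at t within I \<noteq> bot" and "(f has_real_derivative f') (at t within I)"
  shows "conf_deriv k0 k1 I f t = k1 t * f t + k0 t * f'"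
  using assms vector_derivative_within[of t I f f']
  by (simp add: conf_deriv_def has_real_derivative_iff_has_vector_derivative)

lemma differentiable_on_real_derivativeE:
  fixes f :: "real \<Rightarrow> real"
  assumes "f differentiable_on I" and "t \<in> I"
  obtains f' where "(f has_real_derivative f') (at t within I)"
  using assms unfolding differentiable_on_def by (meson real_differentiableE)

text \<open>A connected set with more than one point has no isolated points. This is what makes
  derivatives within \<open>I\<close> unique.\<close>

lemma nondegenerate_interval_at_within:
  fixes I :: "real set"
  assumes "is_interval I" and "\<exists>a\<in>I. \<exists>b\<in>I. a < b" and "t \<in> I"
  shows "at t within I \<noteq> bot"
proof -
  have "t islimpt I"
    by (rule connected_imp_perfect)
      (use assms in \<open>auto simp: is_interval_connected_1\<close>)
  then show ?thesis by (simp add: trivial_limit_within)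
qed

lemma riccati_solution_of_sa_solution:
  assumes nt: "\<And>t. t \<in> I \<Longrightarrow> at t within I \<noteq> bot"
    and k1: "continuous_on I k1"
    and p: "continuous_on I p" "\<And>t. t \<in> I \<Longrightarrow> p t > 0" and q: "continuous_on I q"
    and x: "sa_solution k0 k1 I p q x" "\<And>t. t \<in> I \<Longrightarrow> x t \<noteq> 0"
  shows "riccati_solution k0 k1 I p q (\<lambda>t. p t * conf_deriv k0 k1 I x t / x t)"
proof -
  define u where "u = (\<lambda>t. p t * conf_deriv k0 k1 I x t)"
  define z where "z = (\<lambda>t. u t / x t)"
  have dx: "x differentiable_on I" and du: "u differentiable_on I"
    and eq: "\<And>t. t \<in> I \<Longrightarrow> conf_deriv k0 k1 I u t + q t * x t = 0"
    using x(1) by (auto simp: sa_solution_def u_def sa_op_def)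
  have *: "z differentiable (at t within I)
      \<and> conf_deriv k0 k1 I z t = k1 t * z t - q t - (z t)\<^sup>2 / p t" if t: "t \<in> I" for t
  proof -
    obtain x' where x': "(x has_real_derivative x') (at t within I)"
      using dx t by (rule differentiable_on_real_derivativeE)
    obtain u' where u': "(u has_real_derivative u') (at t within I)"
      using du t by (rule differentiable_on_real_derivativeE)
    have xt: "x t \<noteq> 0" and pt: "p t \<noteq> 0" using x(2) p(2) t by force+
    have z': "(z has_real_derivative (u' * x t - u t * x') / (x t * x t)) (at t within I)"
      unfolding z_def by (rule DERIV_divide[OF u' x' xt])
    \<comment> \<open>The ordinary derivatives are kept multiplied by \<open>k0 t\<close>, since
      these products are what the definition of \<open>u\<close> and the equation
      \<open>Lx = 0\<close> express through \<open>u\<close> and \<open>x\<close>.\<close>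
    have Dx: "k0 t * x' = u t / p t - k1 t * x t"
      using conf_deriv_eq[OF nt[OF t] x', of k0 k1] pt by (simp add: u_def)
    have Du: "k0 t * u' = - q t * x t - k1 t * u t"
      using conf_deriv_eq[OF nt[OF t] u', of k0 k1] eq[OF t] by simp
    have "conf_deriv k0 k1 I z t
        = k1 t * z t + ((k0 t * u') * x t - u t * (k0 t * x')) / (x t * x t)"
      using conf_deriv_eq[OF nt[OF t] z', of k0 k1] by (simp add: algebra_simps)
    also have "\<dots> = k1 t * z t - q t - (z t)\<^sup>2 / p t"
      unfolding Dx Du z_def using xt pt by (simp add: field_simps power2_eq_square)
    finally show ?thesis
      using z' by (auto simp: real_differentiable_def)
  qed
  then have dz: "z differentiable_on I" by (simp add: differentiable_on_def)
  \<comment> \<open>Continuity of the conformable derivative of \<open>z\<close> is read off from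
    the Riccati equation itself, whose other terms are continuous.\<close>
  have "continuous_on I (\<lambda>t. k1 t * z t - q t - (z t)\<^sup>2 / p t)"
    using p by (intro continuous_intros k1 q differentiable_imp_continuous_on[OF dz]) force+
  then have "continuous_on I (conf_deriv k0 k1 I z)"
    by (rule continuous_on_eq) (use * in auto)
  then have "riccati_solution k0 k1 I p q z"
    using dz * by (simp add: riccati_solution_def riccati_op_def)
  then show ?thesis by (simp add: z_def u_def)
qed

lemma sa_solution_of_riccati_solution:
  assumes I: "is_interval I" and nt: "\<And>t. t \<in> I \<Longrightarrow> at t within I \<noteq> bot"
    and k0: "continuous_on I k0" "\<And>t. t \<in> I \<Longrightarrow> k0 t \<noteq> 0" and k1: "continuous_on I k1"
    and p: "continuous_on I p" "\<And>t. t \<in> I \<Longrightarrow> p t > 0" and q: "continuous_on I q"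
    and z: "riccati_solution k0 k1 I p q z"
  obtains x where "sa_solution k0 k1 I p q x" "\<And>t. t \<in> I \<Longrightarrow> x t \<noteq> 0"
    "\<And>t. t \<in> I \<Longrightarrow> z t = p t * conf_deriv k0 k1 I x t / x t"
proof -
  have dz: "z differentiable_on I"
    and eq: "\<And>t. t \<in> I \<Longrightarrow> conf_deriv k0 k1 I z t + q t + (z t)\<^sup>2 / p t - k1 t * z t = 0"
    using z by (auto simp: riccati_solution_def riccati_op_def)
  have cz: "continuous_on I z" using dz by (rule differentiable_imp_continuous_on)
  have p0: "p t \<noteq> 0" if "t \<in> I" for t using p(2)[OF that] by simp
  \<comment> \<open>This quotient is the logarithmic derivative that \<open>x\<close> must have in
    order that \<open>D x / x = z / p\<close>.\<close>
  have "continuous_on I (\<lambda>t. (z t / p t - k1 t) / k0 t)"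
    using p0 k0 by (intro continuous_intros cz p k1) auto
  then obtain G where G:
    "\<And>t. t \<in> I \<Longrightarrow> (G has_real_derivative (z t / p t - k1 t) / k0 t) (at t within I)"
    using interval_antiderivative_exists[OF I] by blast
  define x where "x = (\<lambda>t. exp (G t))"
  have x0: "x t \<noteq> 0" for t by (simp add: x_def)
  have x': "(x has_real_derivative x t * ((z t / p t - k1 t) / k0 t)) (at t within I)"
    if "t \<in> I" for t
    unfolding x_def by (auto intro!: derivative_eq_intros G that)
  have dx: "x differentiable_on I"
    using x' by (auto simp: differentiable_on_def real_differentiable_def)
  have cx: "continuous_on I x" using dx by (rule differentiable_imp_continuous_on)
  have Dx: "conf_deriv k0 k1 I x t = x t * z t / p t" if t: "t \<in> I" for t
    using conf_deriv_eq[OF nt[OF t] x'[OF t], of k0 k1] k0(2)[OF t]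
    by (simp add: field_simps)
  define u where "u = (\<lambda>t. p t * conf_deriv k0 k1 I x t)"
  have u: "u t = x t * z t" if "t \<in> I" for t
    using Dx[OF that] p0[OF that] by (simp add: u_def)
  have *: "u differentiable (at t within I) \<and> conf_deriv k0 k1 I u t = - q t * x t"
    if t: "t \<in> I" for t
  proof -
    obtain z' where z': "(z has_real_derivative z') (at t within I)"
      using dz t by (rule differentiable_on_real_derivativeE)
    have xz: "((\<lambda>t. x t * z t) has_real_derivative
        x t * ((z t / p t - k1 t) / k0 t) * z t + z' * x t) (at t within I)"
      by (rule DERIV_mult[OF x'[OF t] z'])
    \<comment> \<open>The identity \<open>u = x z\<close> is known on \<open>I\<close> only, so the
      derivative is transferred within \<open>I\<close>; the radius 1 is arbitrary.\<close>
    have u': "(u has_real_derivative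
        x t * ((z t / p t - k1 t) / k0 t) * z t + z' * x t) (at t within I)"
      by (rule has_field_derivative_transform_within[OF xz zero_less_one t]) (simp add: u)
    have z'_eq: "k0 t * z' = - q t - (z t)\<^sup>2 / p t"
      using conf_deriv_eq[OF nt[OF t] z', of k0 k1] eq[OF t] by simp
    have "conf_deriv k0 k1 I u t
        = k1 t * (x t * z t) + x t * (z t / p t - k1 t) * z t + (k0 t * z') * x t"
      using conf_deriv_eq[OF nt[OF t] u', of k0 k1] k0(2)[OF t] u[OF t]
      by (simp add: distrib_left)
    \<comment> \<open>The terms \<open>k1 x z\<close> cancel, and so do the terms
      \<open>x z^2 / p\<close>, one from differentiating \<open>x\<close> and one from the Riccati
      equation.\<close>
    also have "\<dots> = - q t * x t"
      unfolding z'_eq by (simp add: algebra_simps power2_eq_square)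
    finally show ?thesis
      using u' by (auto simp: real_differentiable_def)
  qed
  have "continuous_on I (\<lambda>t. x t * z t / p t)"
    using p0 by (intro continuous_intros cx cz p) auto
  then have cDx: "continuous_on I (conf_deriv k0 k1 I x)"
    by (rule continuous_on_eq) (use Dx in auto)
  have "continuous_on I (\<lambda>t. - q t * x t)"
    by (intro continuous_intros cx q)
  then have cDu: "continuous_on I (conf_deriv k0 k1 I u)"
    by (rule continuous_on_eq) (use * in auto)
  have du: "u differentiable_on I" using * by (simp add: differentiable_on_def)
  have "sa_op k0 k1 I p q x t = 0" if "t \<in> I" for t
    using *[OF that] by (simp add: sa_op_def u_def)
  then have "sa_solution k0 k1 I p q x"
    using dx cx cDx cDu du by (simp add: sa_solution_def u_def)
  moreover have "z t = p t * conf_deriv k0 k1 I x t / x t" if "t \<in> I" for t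
    using u[OF that] x0 by (simp add: u_def)
  ultimately show ?thesis using x0 that by blast
qed

theorem theorem6p5:
  fixes I :: "real set"
    and \<kappa>0 \<kappa>1 :: "real \<Rightarrow> real \<Rightarrow> real"
    and \<alpha> :: real
    and p q :: "real \<Rightarrow> real"
  assumes "is_interval I" and "\<exists>a\<in>I. \<exists>b\<in>I. a < b"
    and "continuous_on ({0..1} \<times> I) (\<lambda>(a, t). \<kappa>0 a t)"
    and "continuous_on ({0..1} \<times> I) (\<lambda>(a, t). \<kappa>1 a t)"
    and "\<And>a t. a \<in> {0..1} \<Longrightarrow> t \<in> I \<Longrightarrow> \<kappa>0 a t \<ge> 0"
    and "\<And>a t. a \<in> {0..1} \<Longrightarrow> t \<in> I \<Longrightarrow> \<kappa>1 a t \<ge> 0"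
    and "\<And>t. t \<in> I \<Longrightarrow> ((\<lambda>a. \<kappa>1 a t) \<longlongrightarrow> 1) (at_right 0)"
    and "\<And>t. t \<in> I \<Longrightarrow> ((\<lambda>a. \<kappa>0 a t) \<longlongrightarrow> 0) (at_right 0)"
    and "\<And>t. t \<in> I \<Longrightarrow> ((\<lambda>a. \<kappa>1 a t) \<longlongrightarrow> 0) (at_left 1)"
    and "\<And>t. t \<in> I \<Longrightarrow> ((\<lambda>a. \<kappa>0 a t) \<longlongrightarrow> 1) (at_left 1)"
    and "\<And>a t. a \<in> {0..<1} \<Longrightarrow> t \<in> I \<Longrightarrow> \<kappa>1 a t \<noteq> 0"
    and "\<And>a t. a \<in> {0<..1} \<Longrightarrow> t \<in> I \<Longrightarrow> \<kappa>0 a t \<noteq> 0"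
    and "\<alpha> \<in> {0<..1}"
    and "continuous_on I p" and "continuous_on I q"
    and "\<And>t. t \<in> I \<Longrightarrow> p t > 0"
  shows "((\<exists>x. sa_solution (\<kappa>0 \<alpha>) (\<kappa>1 \<alpha>) I p q x \<and> (\<forall>t\<in>I. x t \<noteq> 0)) \<longleftrightarrow>
            (\<exists>z. riccati_solution (\<kappa>0 \<alpha>) (\<kappa>1 \<alpha>) I p q z)) \<and>
         (\<forall>x. sa_solution (\<kappa>0 \<alpha>) (\<kappa>1 \<alpha>) I p q x \<and> (\<forall>t\<in>I. x t \<noteq> 0) \<longrightarrow>
            riccati_solution (\<kappa>0 \<alpha>) (\<kappa>1 \<alpha>) I p q
              (\<lambda>t. p t * conf_deriv (\<kappa>0 \<alpha>) (\<kappa>1 \<alpha>) I x t / x t)) \<and>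
         (\<forall>z. riccati_solution (\<kappa>0 \<alpha>) (\<kappa>1 \<alpha>) I p q z \<longrightarrow>
            (\<exists>x. sa_solution (\<kappa>0 \<alpha>) (\<kappa>1 \<alpha>) I p q x \<and> (\<forall>t\<in>I. x t \<noteq> 0) \<and>
               (\<forall>t\<in>I. z t = p t * conf_deriv (\<kappa>0 \<alpha>) (\<kappa>1 \<alpha>) I x t / x t)))"
proof -
  have nt: "at t within I \<noteq> bot" if "t \<in> I" for t
    using assms(1,2) that by (rule nondegenerate_interval_at_within)
  \<comment> \<open>Joint continuity is restricted to the slice at the fixed \<alpha>, by composing
    with the map sending \<open>t\<close> to the pair of \<alpha> and \<open>t\<close>.\<close>
  have slice: "continuous_on I (\<kappa> \<alpha>)"
    if "continuous_on ({0..1} \<times> I) (\<lambda>(a, t). \<kappa> a t)" for \<kappa> :: "real \<Rightarrow> real \<Rightarrow> real"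
  proof -
    have "continuous_on I (\<lambda>t. case (\<alpha>, t) of (a, t) \<Rightarrow> \<kappa> a t)"
      by (rule continuous_on_compose2[OF that])
        (use assms(13) in \<open>auto intro!: continuous_intros\<close>)
    then show ?thesis by simp
  qed
  have k0: "continuous_on I (\<kappa>0 \<alpha>)" "\<And>t. t \<in> I \<Longrightarrow> \<kappa>0 \<alpha> t \<noteq> 0"
    using slice[OF assms(3)] assms(12)[OF assms(13)] by auto
  have k1: "continuous_on I (\<kappa>1 \<alpha>)"
    using slice[OF assms(4)] .
  have to_riccati: "riccati_solution (\<kappa>0 \<alpha>) (\<kappa>1 \<alpha>) I p q
      (\<lambda>t. p t * conf_deriv (\<kappa>0 \<alpha>) (\<kappa>1 \<alpha>) I x t / x t)"
    if "sa_solution (\<kappa>0 \<alpha>) (\<kappa>1 \<alpha>) I p q x" "\<forall>t\<in>I. x t \<noteq> 0" for x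
    using nt k1 assms(14,16,15) that(1)
    by (rule riccati_solution_of_sa_solution) (use that(2) in auto)
  have of_riccati: "\<exists>x. sa_solution (\<kappa>0 \<alpha>) (\<kappa>1 \<alpha>) I p q x \<and> (\<forall>t\<in>I. x t \<noteq> 0) \<and>
      (\<forall>t\<in>I. z t = p t * conf_deriv (\<kappa>0 \<alpha>) (\<kappa>1 \<alpha>) I x t / x t)"
    if "riccati_solution (\<kappa>0 \<alpha>) (\<kappa>1 \<alpha>) I p q z" for z
    using sa_solution_of_riccati_solution[OF assms(1) nt k0 k1 assms(14,16,15) that] by metis
  show ?thesis
    using to_riccati of_riccati by blast
qed

end
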